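(* Let $d\ge 4$ and $g\ge 1$ be integers and let $G$ be a $d$-regular graph of girth at least $2g+1$. Then for every integer $1\le r\le g$, \[\mathrm{wcol}_r(G)\ \ge\ \frac{d}{d-3}\left(\Bigl(\frac{d-1}{2}\Bigr)^r-1\right).\]
   Context: All graphs are finite and simple. A linear order on $V(G)$ is an injective map $L\colon V(G)\to\mathbb{N}$; $\Pi(G)$ is the set of all such orders. The length of a path is its number of edges. A vertex $u$ is weakly $r$-reachable from $v$ with respect to $L$ if there is a path $P$ of length $0\le\ell\le r$ from $v$ to $u$ with $L(u)\le L(w)$ for all $w\in V(P)$; $\mathrm{WReach}_r[G,L,v]$ is the set of such $u$. The weak $r$-colouring number is $\mathrm{wcol}_r(G)=\min_{L\in\Pi(G)}\max_{v\in V(G)}|\mathrm{WReach}_r[G,L,v]|$. *)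

theory Defs
  imports Complex_Main "HOL-Library.Extended_Nat" "Graph_Theory.Graph_Theory"
begin

(* Finite simple graphs are the pair_graph instances of 'a pair_pre_digraph: finite, loop-free
   and symmetric, an undirected edge {u, v} being the two arcs (u, v) and (v, u). *)

(* By symmetry of the arc set, out-degree is the usual degree. *)
definition regular_graph :: "nat \<Rightarrow> 'a pair_pre_digraph \<Rightarrow> bool" where
  "regular_graph d G \<longleftrightarrow> (\<forall>v \<in> pverts G. out_degree (with_proj G) v = d)"

(* The length restriction excludes the closed walks (u, v), (v, u) along a single edge, which
   pre_digraph.cycle admits. The infimum is \<infinity> for acyclic graphs. *)
definition girth :: "'a pair_pre_digraph \<Rightarrow> enat" where
  "girth G = (INF p \<in> {p. pre_digraph.cycle (with_proj G) p \<and> 3 \<le> length p}. enat (length p))"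

(* Orders are total functions; only their values on the vertices are relevant. *)
definition linear_orders :: "'a pair_pre_digraph \<Rightarrow> ('a \<Rightarrow> nat) set" where
  "linear_orders G = {L. inj_on L (pverts G)}"

definition WReach :: "nat \<Rightarrow> 'a pair_pre_digraph \<Rightarrow> ('a \<Rightarrow> nat) \<Rightarrow> 'a \<Rightarrow> 'a set" where
  "WReach r G L v =
     {u. \<exists>p. pre_digraph.apath (with_proj G) v p u \<and> length p \<le> r \<and>
             (\<forall>w \<in> set (pre_digraph.awalk_verts (with_proj G) v p). L u \<le> L w)}"

(* The infimum ranges over a nonempty set of naturals when G is finite, so it is attained.
   MAX requires G to be finite and to have at least one vertex. *)
definition wcol :: "nat \<Rightarrow> 'a pair_pre_digraph \<Rightarrow> nat" where
  "wcol r G = (INF L \<in> linear_orders G. MAX v \<in> pverts G. card (WReach r G L v))"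

end

theory Submission
  imports Defs
begin

text \<open>
  Fix an order L and let N i be the number of non-backtracking walks with i edges whose last vertex
  has the least label on the walk. Prolong such a walk backwards at its first vertex. Whatever the
  label of the new vertex, the least label now sits at one of the two ends, so either the new
  walk or its reversal is counted by N (i + 1). This gives d * N 0 \<le> 2 * N 1 and
  (d - 1) * N i \<le> 2 * N (i + 1). As there are no short cycles, a non-backtracking walk with at most
  g edges is a path determined by its ends, so N 1 + ... + N r is at most the sum of the sizes of
  the weak reachability sets. Comparing the average over the vertices with the maximum gives the
  bound as a geometric sum.
\<close>

context pair_graph
begin

section \<open>Non-backtracking walks and the girth\<close>

fun nb_walk :: "'a list \<Rightarrow> bool" where
  "nb_walk [] \<longleftrightarrow> False"
| "nb_walk [x] \<longleftrightarrow> x \<in> pverts G"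
| "nb_walk (x # y # zs) \<longleftrightarrow> (x, y) \<in> parcs G \<and> (zs \<noteq> [] \<longrightarrow> x \<noteq> hd zs) \<and> nb_walk (y # zs)"

lemma nb_walk_imp_vwalk: "nb_walk p \<Longrightarrow> vwalk p (with_proj G)"
  by (induction p rule: nb_walk.induct) (auto simp: vwalk_def dest: in_arcsD1)

lemma nb_walk_verts: "nb_walk p \<Longrightarrow> set p \<subseteq> pverts G"
  using nb_walk_imp_vwalk by (auto simp: vwalk_def)

text \<open>Walks are handled as vertex lists, whose reversal is just \<open>rev\<close>, whereas
  \<open>cycle\<close> and \<open>apath\<close> speak of arc lists. This translates between the
  two.\<close>

lemma vwalk_arcs_awalk:
  assumes "vwalk p (with_proj G)"
  shows "awalk (hd p) (vwalk_arcs p) (last p)" and "pawalk_verts (hd p) (vwalk_arcs p) = p"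
  using assms
  by (induction p rule: vwalk_induct) (auto simp: awalk_Nil_iff awalk_Cons_iff)

text \<open>Gluing at \<open>v\<close> can only backtrack at \<open>v\<close> itself, which the
  different first steps exclude. The induction shifts the junction: the first vertex
  \<open>a\<close> of one walk becomes the new junction, and \<open>v\<close> joins the other
  walk.\<close>

lemma nb_walk_rev_append:
  assumes "nb_walk (v # p)" "nb_walk (v # q)" "p \<noteq> [] \<Longrightarrow> q \<noteq> [] \<Longrightarrow> hd p \<noteq> hd q"
  shows "nb_walk (rev p @ v # q)"
  using assms
proof (induction p arbitrary: v q)
  case (Cons a p)
  have "nb_walk (a # p)" "(a, v) \<in> parcs G"
    using Cons.prems(1) arcs_symmetric by auto
  moreover have "nb_walk (a # v # q)"
    using Cons.prems \<open>(a, v) \<in> parcs G\<close> by simp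
  moreover have "hd p \<noteq> hd (v # q)" if "p \<noteq> []"
    using Cons.prems(1) that by auto
  ultimately have "nb_walk (rev p @ a # v # q)"
    by (intro Cons.IH) auto
  then show ?case by simp
qed simp

lemma nb_walk_rev: "nb_walk p \<Longrightarrow> nb_walk (rev p)"
proof (cases p)
  case (Cons v q)
  assume "nb_walk p"
  then show ?thesis
    using nb_walk_rev_append[of v q "[]"] nb_walk_verts[of p] Cons by simp
qed simp

text \<open>By induction the tail is distinct, so a repetition must involve the head
  \<open>a\<close>. The segment from \<open>a\<close> to its recurrence is then a cycle with at most
  \<open>2 * g\<close> edges, contradicting the girth.\<close>

lemma nb_walk_distinct:
  assumes "enat (2 * g + 1) \<le> girth G" "nb_walk p" "length p \<le> 2 * g + 1"
  shows "distinct p"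
  using assms(2,3)
proof (induction p)
  case (Cons a ys)
  show ?case
  proof (cases "ys = []")
    case False
    have "nb_walk ys"
      using Cons.prems(1) False by (cases ys) auto
    then have dist: "distinct ys"
      using Cons by simp
    have "a \<notin> set ys"
    proof
      assume "a \<in> set ys"
      then obtain bs cs where ys: "ys = bs @ a # cs"
        by (meson split_list)
      define c where "c = a # bs @ [a]"
      have "vwalk c (with_proj G)"
        using nb_walk_imp_vwalk[OF Cons.prems(1)] vwalkI_append_l[of c cs]
        by (simp add: c_def ys)
      from vwalk_arcs_awalk[OF this]
      have "awalk a (vwalk_arcs c) a" "pawalk_verts a (vwalk_arcs c) = c"
        by (simp_all add: c_def)
      moreover have "distinct (tl c)"
        using dist by (simp add: c_def ys)
      moreover have len: "length (vwalk_arcs c) = length bs + 1"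
        using vwalk_length_simp[of c] unfolding vwalk_length_def by (simp add: c_def)
      ultimately have "cycle (vwalk_arcs c)"
        by (auto simp: cycle_def c_def)
      \<comment> \<open>Counting only cycles of length at least 3 requires ruling out a loop
        (\<open>bs\<close> empty) and an immediate return (\<open>bs\<close> a singleton).\<close>
      moreover have "2 \<le> length bs"
      proof -
        have "bs \<noteq> []"
          using Cons.prems(1) no_loops'[of a a] by (auto simp: ys)
        moreover have "bs \<noteq> [b]" for b
          using Cons.prems(1) by (auto simp: ys)
        ultimately show ?thesis
          \<comment> \<open>This rule serves only to split a list into the cases of zero, one, or at
            least two elements.\<close>
          by (cases bs rule: remdups_adj.cases) auto
      qed
      ultimately have "girth G \<le> enat (length bs + 1)"
        unfolding girth_def using len by (intro INF_lower2[of "vwalk_arcs c"]) auto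
      then have "enat (2 * g + 1) \<le> enat (length bs + 1)"
        using assms(1) order_trans by blast
      then show False
        using Cons.prems(2) by (simp add: ys)
    qed
    then show ?thesis
      using dist by simp
  qed simp
qed simp

text \<open>A common first step is removed by induction. If the walks part at once, the reversal of
  one glued to the other is non-backtracking with at most \<open>2 * g + 1\<close> vertices, yet it
  visits the common last vertex twice.\<close>

lemma nb_walk_unique:
  assumes "enat (2 * g + 1) \<le> girth G"
    and "nb_walk p" "nb_walk q" "hd p = hd q" "last p = last q"
    and "length p \<le> g + 1" "length q \<le> g + 1"
  shows "p = q"
  using assms(2-)
proof (induction p arbitrary: q)
  case (Cons v p)
  then obtain q' where q: "q = v # q'"
    by (cases q) auto
  have dist: "distinct (v # p)" "distinct (v # q')"
    using Cons.prems q by (auto intro!: nb_walk_distinct[OF assms(1)] simp del: distinct.simps)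
  consider "p = []" | "q' = []" | a p1 b q1 where "p = a # p1" "q' = b # q1"
    by (meson neq_Nil_conv)
  then show ?case
  proof cases
    case 1
    then show ?thesis
      using Cons.prems(4) dist q by (cases "q' = []") auto
  next
    case 2
    then show ?thesis
      using Cons.prems(4) dist q by (cases "p = []") (auto dest: last_in_set)
  next
    case (3 a p1 b q1)
    show ?thesis
    proof (cases "a = b")
      case True
      then show ?thesis
        using Cons.IH[of q'] Cons.prems 3 q by auto
    next
      case False
      have "nb_walk (rev p @ v # q')"
        using Cons.prems 3 False q by (intro nb_walk_rev_append) auto
      then have "distinct (rev p @ v # q')"
        using Cons.prems q by (intro nb_walk_distinct[OF assms(1)]) auto
      moreover have "last p \<in> set p" "last p \<in> set q'"
        using Cons.prems(4) 3 q by (auto dest: last_in_set split: if_splits)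
      ultimately show ?thesis by auto
    qed
  qed
qed simp

section \<open>Counting walks that end at their least label\<close>

text \<open>The index \<open>k\<close> counts edges, while \<open>length\<close> counts vertices;
  the cardinality is the N k of the overview.\<close>

definition min_walks :: "('a \<Rightarrow> nat) \<Rightarrow> nat \<Rightarrow> 'a list set" where
  "min_walks L k = {p. nb_walk p \<and> length p = Suc k \<and> (\<forall>w \<in> set p. L (last p) \<le> L w)}"

lemma finite_min_walks: "finite (min_walks L k)"
  by (rule finite_subset[OF _ finite_lists_length_eq[OF pair_finite_verts, of "Suc k"]])
    (auto simp: min_walks_def dest: nb_walk_verts)

lemma card_min_walks_0: "card (min_walks L 0) = card (pverts G)"
proof -
  have "min_walks L 0 = (\<lambda>v. [v]) ` pverts G"
    by (auto simp: min_walks_def length_Suc_conv)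
  then show ?thesis
    by (simp add: card_image inj_on_def)
qed

lemma card_neighbours:
  assumes "regular_graph d G" "v \<in> pverts G"
  shows "card {y. (y, v) \<in> parcs G} = d"
proof -
  have "out_arcs (with_proj G) v = Pair v ` {y. (y, v) \<in> parcs G}"
    using arcs_symmetric by (auto simp: out_arcs_def)
  then have "out_degree (with_proj G) v = card {y. (y, v) \<in> parcs G}"
    by (simp add: out_degree_def card_image inj_on_def)
  then show ?thesis
    using assms by (simp add: regular_graph_def)
qed

text \<open>Every neighbour of the first vertex may be prepended, except the second vertex of the
  walk if there is one.\<close>

lemma card_nb_extensions:
  assumes "regular_graph d G" "nb_walk p"
  shows "card {y. nb_walk (y # p)} = (if length p = 1 then d else d - 1)"
proof (cases p rule: remdups_adj.cases)
  case 1
  then show ?thesis using assms by simp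
next
  case (2 v)
  then have "{y. nb_walk (y # p)} = {y. (y, v) \<in> parcs G}"
    using assms(2) by auto
  then show ?thesis
    using card_neighbours[OF assms(1)] assms(2) 2 by simp
next
  case (3 v w q)
  have "{y. nb_walk (y # p)} = {y. (y, v) \<in> parcs G} - {w}"
    using assms(2) 3 by auto
  moreover have "w \<in> {y. (y, v) \<in> parcs G}"
    using assms(2) 3 arcs_symmetric by auto
  moreover have "v \<in> pverts G"
    using nb_walk_verts[OF assms(2)] 3 by simp
  ultimately show ?thesis
    using card_neighbours[OF assms(1)] 3 by simp
qed

lemma card_min_walks_Suc:
  assumes "regular_graph d G"
  shows "card (min_walks L k) * (if k = 0 then d else d - 1) \<le> 2 * card (min_walks L (Suc k))"
proof -
  let ?M = "min_walks L (Suc k)"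
  define X where "X = (SIGMA p : min_walks L k. {y. nb_walk (y # p)})"
  have fin: "finite {y. nb_walk (y # p)}" for p
    using pair_finite_verts by (rule rev_finite_subset) (auto dest: nb_walk_verts)
  have "card X = (\<Sum>p\<in>min_walks L k. card {y. nb_walk (y # p)})"
    unfolding X_def using fin finite_min_walks by simp
  also have "\<dots> = (\<Sum>p\<in>min_walks L k. if k = 0 then d else d - 1)"
    by (rule sum.cong) (auto simp: min_walks_def card_nb_extensions[OF assms])
  finally have "card X = card (min_walks L k) * (if k = 0 then d else d - 1)"
    by simp
  moreover have "card X \<le> card (?M \<union> rev ` ?M)"
  proof (rule card_inj_on_le[where f = "\<lambda>(p, y). y # p"])
    show "(\<lambda>(p, y). y # p) ` X \<subseteq> ?M \<union> rev ` ?M"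
    proof clarify
      fix p y assume "(p, y) \<in> X" "y # p \<notin> rev ` ?M"
      then have p: "p \<in> min_walks L k" "nb_walk (y # p)"
        by (auto simp: X_def)
      have "p \<noteq> []"
        using p(1) by (auto simp: min_walks_def)
      \<comment> \<open>If \<open>y\<close> had a smaller label than \<open>last p\<close>, it would
        be least on the whole walk, and the reversal, which ends at \<open>y\<close>, would lie in
        \<open>?M\<close>.\<close>
      have "rev (y # p) \<notin> ?M"
        using \<open>y # p \<notin> rev ` ?M\<close> by (metis imageI rev_rev_ident)
      moreover have "nb_walk (rev (y # p))"
        using nb_walk_rev[OF p(2)] .
      ultimately have "L (last p) \<le> L y"
        using p(1) by (force simp: min_walks_def)
      then show "y # p \<in> ?M"
        using p \<open>p \<noteq> []\<close> by (auto simp: min_walks_def)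
    qed
  qed (auto simp: inj_on_def finite_min_walks)
  moreover have "card (?M \<union> rev ` ?M) \<le> card ?M + card ?M"
    by (rule order_trans[OF card_Un_le]) (simp add: card_image_le finite_min_walks)
  ultimately show ?thesis
    by simp
qed

text \<open>The first prolongation contributes the factor \<open>d / 2\<close>, each later one
  \<open>(d - 1) / 2\<close>.\<close>

lemma card_min_walks_ge:
  assumes "regular_graph d G" "1 \<le> d"
  shows "real (card (pverts G)) * (real d / 2) * ((real d - 1) / 2) ^ k
         \<le> real (card (min_walks L (Suc k)))"
proof (induction k)
  case 0
  have "real (card (min_walks L 0) * d) \<le> real (2 * card (min_walks L (Suc 0)))"
    using card_min_walks_Suc[OF assms(1), of L 0] by (subst of_nat_le_iff) simp
  then show ?case
    by (simp add: card_min_walks_0)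
next
  case (Suc k)
  have "real (card (min_walks L (Suc k)) * (d - 1)) \<le> real (2 * card (min_walks L (Suc (Suc k))))"
    using card_min_walks_Suc[OF assms(1), of L "Suc k"] by (subst of_nat_le_iff) simp
  then have step: "real (card (min_walks L (Suc k))) * ((real d - 1) / 2)
      \<le> real (card (min_walks L (Suc (Suc k))))"
    using assms(2) by (simp add: of_nat_diff)
  have "real (card (pverts G)) * (real d / 2) * ((real d - 1) / 2) ^ k * ((real d - 1) / 2)
      \<le> real (card (min_walks L (Suc k))) * ((real d - 1) / 2)"
    using assms(2) by (intro mult_right_mono[OF Suc.IH]) simp
  with step show ?case
    by (simp add: mult_ac)
qed

section \<open>From walks to weak reachability sets\<close>

lemma finite_WReach: "finite (WReach r G L v)"
  using pair_finite_verts
  by (rule rev_finite_subset) (auto simp: WReach_def apath_def dest: awalk_last_in_verts)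

lemma last_in_WReach:
  assumes "enat (2 * g + 1) \<le> girth G" "r \<le> g" "k \<le> r" "p \<in> min_walks L k"
  shows "last p \<in> WReach r G L (hd p)"
proof -
  have p: "nb_walk p" "length p = Suc k" "\<forall>w \<in> set p. L (last p) \<le> L w"
    using assms(4) by (auto simp: min_walks_def)
  note aw = vwalk_arcs_awalk[OF nb_walk_imp_vwalk[OF p(1)]]
  have "distinct p"
    using nb_walk_distinct[OF assms(1) p(1)] p(2) assms by simp
  then have "apath (hd p) (vwalk_arcs p) (last p)"
    using aw by (simp add: apath_def)
  moreover have "length (vwalk_arcs p) \<le> r"
    using vwalk_length_simp[of p] p(2) assms(3) unfolding vwalk_length_def by simp
  ultimately show ?thesis
    using aw(2) p(3) unfolding WReach_def by auto
qed

lemma sum_card_min_walks_le: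
  assumes "enat (2 * g + 1) \<le> girth G" "r \<le> g"
  shows "(\<Sum>k<r. card (min_walks L (Suc k))) \<le> (\<Sum>v\<in>pverts G. card (WReach r G L v))"
proof -
  let ?U = "\<Union>k<r. min_walks L (Suc k)"
  have "(\<Sum>k<r. card (min_walks L (Suc k))) = card ?U"
    \<comment> \<open>The families are disjoint because their walks have different lengths.\<close>
    using finite_min_walks by (subst card_UN_disjoint) (simp_all, auto simp: min_walks_def)
  also have "\<dots> \<le> card (SIGMA v : pverts G. WReach r G L v)"
  proof (rule card_inj_on_le[where f = "\<lambda>p. (hd p, last p)"])
    show "inj_on (\<lambda>p. (hd p, last p)) ?U"
      \<comment> \<open>Walks of different lengths are compared as well; all have at most
        \<open>r + 1\<close>, hence at most \<open>g + 1\<close>, vertices.\<close>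
      using assms(2) by (intro inj_onI nb_walk_unique[OF assms(1)]) (auto simp: min_walks_def)
    have "hd p \<in> pverts G" if "nb_walk p" for p
      using nb_walk_verts[OF that] that by (cases p) auto
    then show "(\<lambda>p. (hd p, last p)) ` ?U \<subseteq> (SIGMA v : pverts G. WReach r G L v)"
      using last_in_WReach[OF assms] by (fastforce simp: min_walks_def)
    show "finite (SIGMA v : pverts G. WReach r G L v)"
      using pair_finite_verts finite_WReach by (rule finite_SigmaI)
  qed
  also have "\<dots> = (\<Sum>v\<in>pverts G. card (WReach r G L v))"
    using pair_finite_verts finite_WReach by simp
  finally show ?thesis .
qed

lemma Max_card_WReach_ge:
  assumes "regular_graph d G" "4 \<le> d" "enat (2 * g + 1) \<le> girth G" "r \<le> g" "pverts G \<noteq> {}"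
  shows "real d / (real d - 3) * (((real d - 1) / 2) ^ r - 1)
         \<le> real (MAX v \<in> pverts G. card (WReach r G L v))"
proof -
  let ?n = "real (card (pverts G))" and ?x = "(real d - 1) / 2"
  let ?m = "MAX v \<in> pverts G. card (WReach r G L v)"
  have "?x \<noteq> 1" "0 < ?n"
    using assms pair_finite_verts by (auto simp: card_gt_0_iff)
  have "?n * (real d / (real d - 3) * (?x ^ r - 1)) = ?n * (real d / 2) * (\<Sum>k<r. ?x ^ k)"
    \<comment> \<open>As \<open>?x - 1 = (d - 3) / 2\<close>, the factor \<open>d / 2\<close> in
      front of the geometric sum turns into \<open>d / (d - 3)\<close>.\<close>
    using assms(2) by (subst geometric_sum[OF \<open>?x \<noteq> 1\<close>]) (simp add: field_simps)
  also have "\<dots> = (\<Sum>k<r. ?n * (real d / 2) * ?x ^ k)"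
    by (rule sum_distrib_left)
  also have "\<dots> \<le> (\<Sum>k<r. real (card (min_walks L (Suc k))))"
    using assms by (intro sum_mono card_min_walks_ge) auto
  also have "\<dots> = real (\<Sum>k<r. card (min_walks L (Suc k)))"
    by simp
  also have "\<dots> \<le> real (\<Sum>v\<in>pverts G. card (WReach r G L v))"
    using sum_card_min_walks_le[OF assms(3,4)] by (subst of_nat_le_iff)
  also have "\<dots> \<le> real (\<Sum>v\<in>pverts G. ?m)"
    using pair_finite_verts by (subst of_nat_le_iff) (intro sum_mono Max_ge, auto)
  also have "\<dots> = ?n * real ?m"
    by simp
  finally show ?thesis
    using \<open>0 < ?n\<close> by (simp only: mult_le_cancel_left_pos)
qed

text \<open>Finiteness provides at least one order, and an infimum over a nonempty set of naturals
  is attained. A bound valid for every \<open>L\<close> thus passes to \<open>wcol\<close>.\<close>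

lemma wcol_attained: "\<exists>L \<in> linear_orders G. wcol r G = (MAX v \<in> pverts G. card (WReach r G L v))"
proof -
  have "linear_orders G \<noteq> {}"
    using finite_imp_inj_to_nat_seg[OF pair_finite_verts] by (auto simp: linear_orders_def)
  then have "wcol r G \<in> (\<lambda>L. MAX v \<in> pverts G. card (WReach r G L v)) ` linear_orders G"
    unfolding wcol_def by (intro Inf_nat_def1) simp
  then show ?thesis by auto
qed

end

theorem theorem5:
  fixes G :: "'a pair_pre_digraph" and d g r :: nat
  assumes "d \<ge> 4" and "g \<ge> 1"
    and "pair_graph G" and "pverts G \<noteq> {}"
    and "regular_graph d G"
    and "girth G \<ge> enat (2 * g + 1)"
    and "1 \<le> r" and "r \<le> g"
  shows "real (wcol r G) \<ge> real d / (real d - 3) * (((real d - 1) / 2) ^ r - 1)"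
proof -
  interpret pair_graph G by fact
  show ?thesis
    using wcol_attained[of r] Max_card_WReach_ge[of d g r] assms by auto
qed

end
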